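(* For every $t\in\mathbb{C}\setminus\{0\}$ and every integer $m\ge 0$, $$\left.\frac{\partial Y_{\nu}(t)}{\partial\nu}\right|_{\nu=m}+(-1)^{m}\left.\frac{\partial Y_{\nu}(t)}{\partial\nu}\right|_{\nu=-m}=-\pi\,J_{m}(t).$$
   Context: $J_\nu(t)=\sum_{k=0}^{\infty}\frac{(-1)^k}{k!\,\Gamma(k+\nu+1)}\left(\frac{t}{2}\right)^{2k+\nu}$ is the Bessel function of the first kind (principal branch, $-\pi<\arg t\le\pi$; $1/\Gamma$ is zero at the poles of $\Gamma$), and $Y_\nu(t)=\frac{J_\nu(t)\cos\pi\nu-J_{-\nu}(t)}{\sin\pi\nu}$ (for integer $\nu$, the limit in $\nu$) is the Bessel function of the second kind. *)

theory Defs
  imports "HOL-Analysis.Analysis"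
begin

(* powr on the complex numbers is taken with the principal logarithm, -pi < Im (Ln z) <= pi;
   rGamma is the entire function 1/Gamma, zero at the poles of Gamma. *)
definition bessel_J :: "complex \<Rightarrow> complex \<Rightarrow> complex" where
  "bessel_J \<nu> t =
     (\<Sum>k. (- 1) ^ k / fact k * rGamma (of_nat k + \<nu> + 1)
            * (t / 2) powr (2 * of_nat k + \<nu>))"

definition bessel_Y_quotient :: "complex \<Rightarrow> complex \<Rightarrow> complex" where
  "bessel_Y_quotient \<nu> t =
     (bessel_J \<nu> t * cos (of_real pi * \<nu>) - bessel_J (- \<nu>) t) / sin (of_real pi * \<nu>)"

definition bessel_Y :: "complex \<Rightarrow> complex \<Rightarrow> complex" where
  "bessel_Y \<nu> t =
     (if \<nu> \<in> \<int> then Lim (at \<nu>) (\<lambda>\<mu>. bessel_Y_quotient \<mu> t) else bessel_Y_quotient \<nu> t)"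

end

theory Submission
  imports Defs "HOL-Complex_Analysis.Cauchy_Integral_Formula"
begin

text \<open>
  The series of \<open>J\<^sub>\<nu>(t)\<close> converges locally uniformly in \<open>\<nu>\<close>, so \<open>J\<^sub>\<nu>(t)\<close> is entire in \<open>\<nu>\<close>. Its
  reflection at integers makes the numerator of \<open>Y\<^sub>\<nu>(t)\<close> vanish where \<open>sin \<pi>\<nu>\<close> has its (simple)
  zeros, so \<open>Y\<^sub>\<nu>(t)\<close> is entire as well. Off the integers the definition gives
  \<open>Y\<^sub>\<nu> cos \<pi>\<nu> - Y\<^sub>-\<^sub>\<nu> + J\<^sub>\<nu> sin \<pi>\<nu> = 0\<close>. By continuity this holds for every \<open>\<nu>\<close>, and
  differentiating it at \<open>\<nu> = m\<close> gives the theorem.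
\<close>

section \<open>Holomorphy of the Bessel function of the first kind in its order\<close>

definition bessel_J_term :: "complex \<Rightarrow> nat \<Rightarrow> complex \<Rightarrow> complex" where
  "bessel_J_term t k \<nu> =
     (- 1) ^ k / fact k * rGamma (of_nat k + \<nu> + 1) * (t / 2) powr (2 * of_nat k + \<nu>)"

lemma bessel_J_eq_suminf: "bessel_J \<nu> t = (\<Sum>k. bessel_J_term t k \<nu>)"
  by (simp add: bessel_J_def bessel_J_term_def)

lemma norm_pochhammer_ge_1:
  fixes z :: complex
  assumes "Re z \<ge> 1"
  shows "norm (pochhammer z n) \<ge> 1"
proof (induction n)
  case (Suc n)
  have "1 \<le> Re (z + of_nat n)"
    using assms by simp
  also have "\<dots> \<le> norm (z + of_nat n)"
    by (rule complex_Re_le_cmod)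
  finally have "1 * 1 \<le> norm (pochhammer z n) * norm (z + of_nat n)"
    using Suc.IH by (intro mult_mono) auto
  then show ?case
    by (simp add: pochhammer_Suc norm_mult)
qed simp

text \<open>The functional equation gives
  \<open>rGamma z = pochhammer z n * rGamma (z + of_nat n)\<close>, and the Pochhammer factor has
  norm at least 1. This bounds the reciprocal Gamma factors of all late terms by a single
  one.\<close>

lemma norm_rGamma_plus_of_nat_le:
  fixes z :: complex
  assumes "Re z \<ge> 1"
  shows "norm (rGamma (z + of_nat n)) \<le> norm (rGamma z)"
proof -
  have "1 * norm (rGamma (z + of_nat n)) \<le> norm (pochhammer z n) * norm (rGamma (z + of_nat n))"
    using norm_pochhammer_ge_1[OF assms] by (intro mult_right_mono) auto
  then show ?thesis
    by (simp add: pochhammer_rGamma[of z n] norm_mult)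
qed

text \<open>Splits the power so that its dependence on \<nu> is one entire factor free of
  \<open>k\<close>. At \<open>t = 0\<close> this fails, since \<open>0 powr 0 = 0\<close>.\<close>

lemma bessel_J_term_eq:
  assumes "t \<noteq> 0"
  shows "bessel_J_term t k \<nu> =
    (- 1) ^ k / fact k * rGamma (of_nat k + \<nu> + 1) * (((t / 2)\<^sup>2) ^ k * exp (\<nu> * Ln (t / 2)))"
proof -
  have "(t / 2) powr (2 * of_nat k) = ((t / 2)\<^sup>2) ^ k"
    using assms powr_nat'[of "t / 2" "2 * k"] by (simp only: power_mult) simp
  then show ?thesis
    using assms by (simp add: bessel_J_term_def powr_add powr_def[of _ \<nu>])
qed

lemma uniform_limit_bessel_J:
  assumes "t \<noteq> 0"
  shows "uniform_limit (cball a 1) (\<lambda>n \<nu>. \<Sum>k<n. bessel_J_term t k \<nu>)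
           (\<lambda>\<nu>. bessel_J \<nu> t) sequentially"
proof -
  \<comment> \<open>On the ball \<open>Re \<nu> \<ge> Re a - 1\<close>, so this \<open>K\<close>
    gives \<open>Re (of_nat K + \<nu> + 1) \<ge> 1\<close> there. From index \<open>K\<close> on,
    the terms are dominated by a multiple of the exponential series; the finitely many earlier ones
    are left to the eventual form of the M-test.\<close>
  obtain K :: nat where K: "1 - Re a \<le> of_nat K"
    using real_arch_simple by blast
  define g where "g \<nu> = rGamma (of_nat K + \<nu> + 1) * exp (\<nu> * Ln (t / 2))" for \<nu>
  have "continuous_on (cball a 1) g"
    unfolding g_def
    by (intro holomorphic_on_imp_continuous_on holomorphic_intros)
  then have "bounded (g ` cball a 1)"
    by (intro compact_imp_bounded compact_continuous_image) auto
  then obtain B where B: "\<And>\<nu>. \<nu> \<in> cball a 1 \<Longrightarrow> norm (g \<nu>) \<le> B"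
    unfolding bounded_iff by blast
  define M where "M k = B * (inverse (fact k) * (norm (t / 2) ^ 2) ^ k)" for k :: nat
  have bound: "norm (bessel_J_term t k \<nu>) \<le> M k" if k: "k \<ge> K" and \<nu>: "\<nu> \<in> cball a 1" for k \<nu>
  proof -
    have "Re (a - \<nu>) \<le> norm (a - \<nu>)"
      by (rule complex_Re_le_cmod)
    also have "\<dots> \<le> 1"
      using \<nu> by (simp add: dist_norm)
    finally have "1 \<le> Re (of_nat K + \<nu> + 1)"
      using K by simp
    from norm_rGamma_plus_of_nat_le[OF this, of "k - K"]
    have "norm (rGamma (of_nat k + \<nu> + 1)) \<le> norm (rGamma (of_nat K + \<nu> + 1))"
      using k by (simp add: of_nat_diff algebra_simps)
    then have "norm (rGamma (of_nat k + \<nu> + 1)) * norm (exp (\<nu> * Ln (t / 2))) \<le> norm (g \<nu>)"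
      unfolding g_def norm_mult by (intro mult_right_mono) auto
    also have "\<dots> \<le> B"
      using B \<nu> by blast
    finally have *: "norm (rGamma (of_nat k + \<nu> + 1)) * norm (exp (\<nu> * Ln (t / 2))) \<le> B" .
    have "norm (bessel_J_term t k \<nu>) =
        (norm (rGamma (of_nat k + \<nu> + 1)) * norm (exp (\<nu> * Ln (t / 2)))) *
        (inverse (fact k) * (norm (t / 2) ^ 2) ^ k)"
      unfolding bessel_J_term_eq[OF assms]
      by (simp only: norm_mult norm_divide norm_power norm_fact norm_minus_cancel norm_one
            norm_inverse power_one divide_inverse mult_1_left ac_simps)
    also have "\<dots> \<le> M k"
      unfolding M_def using * by (rule mult_right_mono) simp
    finally show ?thesis .
  qed
  have "summable M"
    unfolding M_def by (intro summable_mult summable_exp)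
  moreover have "\<forall>\<^sub>F k in sequentially. \<forall>\<nu>\<in>cball a 1. norm (bessel_J_term t k \<nu>) \<le> M k"
    unfolding eventually_sequentially using bound by blast
  ultimately show ?thesis
    unfolding bessel_J_eq_suminf by (intro Weierstrass_m_test_ev)
qed

lemma bessel_J_sums:
  assumes "t \<noteq> 0"
  shows "(\<lambda>k. bessel_J_term t k \<nu>) sums bessel_J \<nu> t"
  unfolding sums_def
  using tendsto_uniform_limitI[OF uniform_limit_bessel_J[OF assms, of \<nu>]] by simp

lemma holomorphic_bessel_J:
  assumes "t \<noteq> 0"
  shows "(\<lambda>\<nu>. bessel_J \<nu> t) holomorphic_on UNIV"
proof (rule holomorphic_uniform_sequence)
  show "(\<lambda>\<nu>. \<Sum>k<n. bessel_J_term t k \<nu>) holomorphic_on UNIV" for n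
    unfolding bessel_J_term_eq[OF assms] by (intro holomorphic_intros) auto
  show "\<exists>d>0. cball a d \<subseteq> UNIV \<and>
      uniform_limit (cball a d) (\<lambda>n \<nu>. \<Sum>k<n. bessel_J_term t k \<nu>) (\<lambda>\<nu>. bessel_J \<nu> t) sequentially" for a
    using uniform_limit_bessel_J[OF assms, of a] zero_less_one by blast
qed (rule open_UNIV)

lemma holomorphic_bessel_J_compose [holomorphic_intros]:
  assumes "t \<noteq> 0" "f holomorphic_on A"
  shows "(\<lambda>z. bessel_J (f z) t) holomorphic_on A"
  using holomorphic_on_compose_gen[OF assms(2) holomorphic_bessel_J[OF assms(1)]]
  by (simp add: o_def)

section \<open>Reflection at integer order and the zeros of the numerator\<close>

text \<open>The first \<open>m\<close> terms of the series at \<open>- m\<close> vanish because \<open>1 / \<Gamma>\<close> does.\<close>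
lemma bessel_J_minus_of_nat:
  assumes "t \<noteq> 0"
  shows "bessel_J (- of_nat m) t = (- 1) ^ m * bessel_J (of_nat m) t"
proof -
  have shift: "bessel_J_term t (k + m) (- of_nat m) = (- 1) ^ m * bessel_J_term t k (of_nat m)" for k
  proof -
    have 1: "of_nat (k + m) + (- of_nat m) + 1 = (1 + of_nat k :: complex)"
      and 2: "of_nat k + of_nat m + 1 = (1 + of_nat (k + m) :: complex)"
      and 3: "2 * of_nat (k + m) + - of_nat m = (2 * of_nat k + of_nat m :: complex)"
      by simp_all
    have rG: "rGamma (1 + of_nat n :: complex) = inverse (fact n)" for n
      by (simp add: rGamma_inverse_Gamma Gamma_fact)
    show ?thesis
      unfolding bessel_J_term_def 1 2 3 rG by (simp only: power_add divide_inverse mult_ac)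
  qed
  have "bessel_J_term t k (- of_nat m) = 0" if "k < m" for k
  proof -
    have "of_nat k + (- of_nat m) + 1 = (- of_nat (m - Suc k) :: complex)"
      using that by (simp add: of_nat_diff)
    then have "rGamma (of_nat k + (- of_nat m) + 1 :: complex) = 0"
      by (simp only: rGamma_neg_of_nat)
    then show ?thesis
      by (simp only: bessel_J_term_def mult_zero_left mult_zero_right)
  qed
  then have "(\<lambda>k. bessel_J_term t (k + m) (- of_nat m)) sums bessel_J (- of_nat m) t"
    using bessel_J_sums[OF assms, of "- of_nat m"] by (subst sums_zero_iff_shift)
  moreover have "(\<lambda>k. bessel_J_term t (k + m) (- of_nat m)) sums ((- 1) ^ m * bessel_J (of_nat m) t)"
    unfolding shift by (intro sums_mult bessel_J_sums assms)
  ultimately show ?thesis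
    by (rule sums_unique2)
qed

lemma cos_pi_of_int: "cos (of_real pi * of_int n :: complex) = (- 1) ^ nat \<bar>n\<bar>"
proof (cases "n \<ge> 0")
  case True
  then show ?thesis
    using cos_npi_complex'[of "nat n", where 'a = complex] by (simp add: mult.commute)
next
  case False
  then have "cos (- (of_nat (nat (- n)) * of_real pi) :: complex) = (- 1) ^ nat (- n)"
    by (simp only: cos_minus cos_npi_complex')
  then show ?thesis
    using False by (simp add: mult.commute)
qed

lemma bessel_Y_numerator_zero:
  assumes "t \<noteq> 0"
  shows "bessel_J (of_int n) t * cos (of_real pi * of_int n) - bessel_J (- of_int n) t = 0"
proof (cases n rule: int_cases2)
  case (nonneg m)
  then show ?thesis
    using bessel_J_minus_of_nat[OF assms, of m] cos_pi_of_int[of n] by simp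
next
  case (nonpos m)
  have "(- 1) ^ m * ((- 1) ^ m * x) = x" for x :: complex
    by (simp flip: mult.assoc power_mult_distrib)
  then show ?thesis
    using bessel_J_minus_of_nat[OF assms, of m] cos_pi_of_int[of n] nonpos by (simp add: mult.commute)
qed

section \<open>Removable singularities at integer order\<close>

lemma sin_pi_times_eq_0_iff: "sin (of_real pi * z) = 0 \<longleftrightarrow> z \<in> \<int>" for z :: complex
proof -
  have "of_real pi * z = of_real (of_int n * pi) \<longleftrightarrow> z = of_int n" for n
    by simp
  then show ?thesis
    unfolding sin_eq_0 by (auto elim: Ints_cases)
qed

text \<open>Dividing \<open>f\<close> and \<open>g\<close> by \<open>z - a\<close> leaves difference
  quotients that become holomorphic once \<open>a\<close> is assigned the derivative. Their quotient
  is the function in question, and its denominator at \<open>a\<close> is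
  \<open>deriv g a\<close>.\<close>

lemma field_differentiable_removable_quotient:
  fixes f g :: "complex \<Rightarrow> complex"
  assumes "f holomorphic_on S" "g holomorphic_on S" "open S" "a \<in> S"
    and "f a = 0" "g a = 0" "deriv g a \<noteq> 0"
  shows "(\<lambda>z. if z = a then deriv f a / deriv g a else f z / g z) field_differentiable (at a)"
proof -
  let ?q = "\<lambda>h z. if z = a then deriv h a else (h z - h a) / (z - a)"
  have "?q h field_differentiable (at a)" if "h holomorphic_on S" for h
    using pole_lemma_open[OF that assms(3)] assms(3,4) holomorphic_on_imp_differentiable_at by blast
  then have "(\<lambda>z. ?q f z / ?q g z) field_differentiable (at a)"
    using assms by (intro field_differentiable_divide) auto
  also have "(\<lambda>z. ?q f z / ?q g z) = (\<lambda>z. if z = a then deriv f a / deriv g a else f z / g z)"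
    using assms by (auto simp: fun_eq_iff)
  finally show ?thesis .
qed

lemma eventually_not_Ints: "\<forall>\<^sub>F z in at a. z \<notin> \<int>" for a :: complex
proof -
  have "open (- (\<int> - {a}))"
    by (intro open_Compl closed_subset_Ints) auto
  then show ?thesis
    using eventually_at_topological by blast
qed

lemma field_differentiable_bessel_Y_of_int:
  assumes "t \<noteq> 0"
  shows "(\<lambda>\<nu>. bessel_Y \<nu> t) field_differentiable (at (of_int n))"
proof -
  let ?a = "of_int n :: complex"
  let ?f = "\<lambda>\<nu>. bessel_J \<nu> t * cos (of_real pi * \<nu>) - bessel_J (- \<nu>) t"
  let ?g = "\<lambda>\<nu>::complex. sin (of_real pi * \<nu>)"
  define F where "F \<nu> = (if \<nu> = ?a then deriv ?f ?a / deriv ?g ?a else ?f \<nu> / ?g \<nu>)" for \<nu>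
  have g': "(?g has_field_derivative of_real pi * cos (of_real pi * ?a)) (at ?a)"
    by (auto intro!: derivative_eq_intros)
  have F: "F field_differentiable (at ?a)"
    unfolding F_def
  proof (rule field_differentiable_removable_quotient[where S = UNIV])
    show "?f holomorphic_on UNIV" "?g holomorphic_on UNIV"
      using assms by (auto intro!: holomorphic_intros)
    show "?f ?a = 0"
      by (rule bessel_Y_numerator_zero[OF assms])
    show "?g ?a = 0"
      by (simp add: sin_pi_times_eq_0_iff)
    show "deriv ?g ?a \<noteq> 0"
      by (simp add: DERIV_imp_deriv[OF g'] cos_pi_of_int)
  qed auto
  have "F \<midarrow>?a\<rightarrow> F ?a"
    using field_differentiable_imp_continuous_at[OF F] by (simp add: continuous_at)
  \<comment> \<open>Off \<open>?a\<close> the two sides are the same expression, so the limit that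
    defines \<open>bessel_Y ?a t\<close> is \<open>F ?a\<close>.\<close>
  moreover have "\<forall>\<^sub>F \<nu> in at ?a. F \<nu> = bessel_Y_quotient \<nu> t"
    by (auto simp: F_def bessel_Y_quotient_def eventually_at_filter)
  ultimately have "(\<lambda>\<nu>. bessel_Y_quotient \<nu> t) \<midarrow>?a\<rightarrow> F ?a"
    by (rule Lim_transform_eventually)
  then have Ya: "bessel_Y ?a t = F ?a"
    by (simp add: bessel_Y_def tendsto_Lim)
  \<comment> \<open>At other integers \<open>bessel_Y\<close> is a limit while \<open>F\<close> is a
    division by zero, so agreement is claimed only near \<open>?a\<close>.\<close>
  have "\<forall>\<^sub>F \<nu> in at ?a. F \<nu> = bessel_Y \<nu> t"
    using eventually_not_Ints[of ?a]
    by eventually_elim (auto simp: F_def bessel_Y_def bessel_Y_quotient_def)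
  with Ya have "\<forall>\<^sub>F \<nu> in nhds ?a. F \<nu> = bessel_Y \<nu> t"
    by (simp add: eventually_nhds_conv_at)
  then have "(F has_field_derivative D) (at ?a) \<longleftrightarrow>
      ((\<lambda>\<nu>. bessel_Y \<nu> t) has_field_derivative D) (at ?a)" for D
    by (intro DERIV_cong_ev) auto
  with F show ?thesis
    by (simp add: field_differentiable_def)
qed

section \<open>The functional equation and its derivative\<close>

text \<open>After multiplication by the sine, which is odd, the terms with
  \<open>bessel_J (- \<nu>) t\<close> cancel and the rest vanishes by the Pythagorean
  identity.\<close>

lemma bessel_Y_reflection:
  assumes "\<nu> \<notin> \<int>"
  shows "bessel_Y \<nu> t * cos (of_real pi * \<nu>) - bessel_Y (- \<nu>) t
           + bessel_J \<nu> t * sin (of_real pi * \<nu>) = 0"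
proof -
  let ?c = "cos (of_real pi * \<nu>)" and ?s = "sin (of_real pi * \<nu>)"
  have s: "?s \<noteq> 0"
    using assms by (simp add: sin_pi_times_eq_0_iff)
  have "bessel_Y \<nu> t * ?s = bessel_J \<nu> t * ?c - bessel_J (- \<nu>) t"
    "bessel_Y (- \<nu>) t * ?s = bessel_J \<nu> t - bessel_J (- \<nu>) t * ?c"
    using assms s by (simp_all add: bessel_Y_def bessel_Y_quotient_def)
  moreover have "?c * ?c + ?s * ?s = 1"
    by (rule sin_cos_squared_add3)
  ultimately have "?s * (bessel_Y \<nu> t * ?c - bessel_Y (- \<nu>) t + bessel_J \<nu> t * ?s) = 0"
    by algebra
  with s show ?thesis
    by simp
qed

theorem theorem3p5:
  fixes t :: complex and m :: nat
  assumes "t \<noteq> 0"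
  shows "(\<lambda>\<nu>. bessel_Y \<nu> t) field_differentiable (at (of_nat m)) \<and>
         (\<lambda>\<nu>. bessel_Y \<nu> t) field_differentiable (at (- of_nat m)) \<and>
         deriv (\<lambda>\<nu>. bessel_Y \<nu> t) (of_nat m)
           + (- 1) ^ m * deriv (\<lambda>\<nu>. bessel_Y \<nu> t) (- of_nat m)
         = - of_real pi * bessel_J (of_nat m) t"
proof -
  let ?a = "of_nat m :: complex"
  let ?Y = "\<lambda>\<nu>. bessel_Y \<nu> t"
  have diff: "?Y field_differentiable (at ?a)" "?Y field_differentiable (at (- ?a))"
    using field_differentiable_bessel_Y_of_int[OF assms, of "int m"]
      field_differentiable_bessel_Y_of_int[OF assms, of "- int m"] by simp_all
  define A where "A \<nu> = bessel_Y \<nu> t * cos (of_real pi * \<nu>) - bessel_Y (- \<nu>) t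
    + bessel_J \<nu> t * sin (of_real pi * \<nu>)" for \<nu>
  have [simp]: "cos (of_real pi * ?a) = (- 1) ^ m" "sin (of_real pi * ?a) = 0"
    using cos_pi_of_int[of "int m"] by (simp_all add: sin_pi_times_eq_0_iff)
  have Y: "(?Y has_field_derivative deriv ?Y ?a) (at ?a)"
    "(?Y has_field_derivative deriv ?Y (- ?a)) (at (- ?a))"
    using diff by (simp_all add: field_differentiable_derivI)
  have J: "((\<lambda>\<nu>. bessel_J \<nu> t) has_field_derivative deriv (\<lambda>\<nu>. bessel_J \<nu> t) ?a) (at ?a)"
    using holomorphic_bessel_J[OF assms] by (rule holomorphic_derivI) auto
  have Ym: "((\<lambda>\<nu>. bessel_Y (- \<nu>) t) has_field_derivative deriv ?Y (- ?a) * (- 1)) (at ?a)"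
    by (rule DERIV_chain2[where f = ?Y and g = uminus, OF Y(2)]) (auto intro!: derivative_eq_intros)
  \<comment> \<open>The derivatives of the cosine and of \<open>bessel_J\<close> drop out because
    each comes with a factor \<open>sin (of_real pi * ?a) = 0\<close>.\<close>
  have "(A has_field_derivative
      deriv ?Y ?a * (- 1) ^ m + deriv ?Y (- ?a) + bessel_J ?a t * (of_real pi * (- 1) ^ m)) (at ?a)"
    unfolding A_def by (auto intro!: derivative_eq_intros Y J Ym)
  \<comment> \<open>The reflection formula covers only non-integers. Continuity, read off from the
    derivative just found, extends it to \<open>?a\<close>, so \<open>A\<close> vanishes on a full
    neighbourhood.\<close>
  moreover have "(A has_field_derivative 0) (at ?a)"
  proof -
    have ev: "\<forall>\<^sub>F \<nu> in at ?a. A \<nu> = 0"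
      using eventually_not_Ints[of ?a] by eventually_elim (simp add: A_def bessel_Y_reflection)
    have "A \<midarrow>?a\<rightarrow> A ?a"
      using calculation by (simp add: DERIV_isCont flip: isCont_def)
    moreover have "A \<midarrow>?a\<rightarrow> 0"
      using ev by (rule tendsto_eventually)
    ultimately have "A ?a = 0"
      by (rule LIM_unique)
    with ev have "\<forall>\<^sub>F \<nu> in nhds ?a. A \<nu> = 0"
      by (simp add: eventually_nhds_conv_at)
    then show ?thesis
      using DERIV_cong_ev[of ?a ?a A "\<lambda>_. 0" 0 0] by simp
  qed
  ultimately have eq: "deriv ?Y ?a * (- 1) ^ m + deriv ?Y (- ?a) + bessel_J ?a t * (of_real pi * (- 1) ^ m) = 0"
    by (rule DERIV_unique)
  have sq: "(- 1) ^ m * (- 1) ^ m = (1 :: complex)"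
    by (simp flip: power_mult_distrib)
  \<comment> \<open>Multiplying by the sign \<open>s\<close> and using \<open>s * s = 1\<close>
    isolates the claim; the variables stand for the analytic quantities so that
    \<open>algebra\<close> sees a polynomial identity.\<close>
  have solve: "x + s * y = - p * b" if "x * s + y + b * (p * s) = 0" "s * s = 1"
    for x y b p s :: complex
    using that by algebra
  have "deriv ?Y ?a + (- 1) ^ m * deriv ?Y (- ?a) = - of_real pi * bessel_J ?a t"
    using eq sq by (rule solve)
  with diff show ?thesis
    by blast
qed

end
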